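(* Let $A\in\mathbb{R}^{n\times n}$ be a symmetric positive definite matrix, let $B\in\mathbb{R}^{m\times n}$ and $C\in\mathbb{R}^{p\times m}$ be full row rank matrices, and let $s>0$. Let $\lambda$ be a non-real eigenvalue of the preconditioned matrix $\mathcal{P}_{PESS}^{-1}\mathcal{A}$, i.e. $\Im(\lambda)\neq0$, and suppose ${\bf p}=[u^T,v^T,w^T]^T$ is an eigenvector corresponding to $\lambda$ (with $u\in\mathbb{C}^n$, $v\in\mathbb{C}^m$, $w\in\mathbb{C}^p$). Then the following hold: (1) If $Cv=0$, then $\lambda$ satisfies $$\frac{\xi_{\min}}{2+s\,\xi_{\min}}\leq|\lambda|\leq\sqrt{\frac{\eta_{\max}}{1+s\,\xi_{\min}+s^2\eta_{\max}}}.$$ (2) If $Cv\neq0$, then the real and imaginary parts of $\lambda/(1-s\lambda)$ satisfy $$\frac{\xi_{\min}\,\eta_{\min}}{2\left(\xi_{\max}^2+\eta_{\max}+\theta_{\max}\right)}\leq\Re\left(\frac{\lambda}{1-s\lambda}\right)\leq\frac{\xi_{\max}}{2}\quad\text{and}\quad\left|\Im\left(\frac{\lambda}{1-s\lambda}\right)\right|\leq\sqrt{\eta_{\max}+\theta_{\max}}.$$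
   Context: The saddle point matrix is $\mathcal{A}=\begin{bmatrix}A&B^T&0\\-B&0&-C^T\\0&C&0\end{bmatrix}$. $\Lambda_1\in\mathbb{R}^{n\times n}$, $\Lambda_2\in\mathbb{R}^{m\times m}$, $\Lambda_3\in\mathbb{R}^{p\times p}$ are symmetric positive definite matrices, $\Sigma=\mathrm{diag}(\Lambda_1,\Lambda_2,\Lambda_3)$, and for $s>0$ the PESS preconditioner is $$\mathcal{P}_{PESS}=\Sigma+s\mathcal{A}=\begin{bmatrix}\Lambda_1+sA&sB^T&0\\-sB&\Lambda_2&-sC^T\\0&sC&\Lambda_3\end{bmatrix},$$ which is nonsingular. (Every eigenvalue $\lambda$ of $\mathcal{P}_{PESS}^{-1}\mathcal{A}$ satisfies $\lambda\neq1/s$.) For a matrix with real eigenvalues, $\lambda_{\max}(\cdot)$ and $\lambda_{\min}(\cdot)$ denote its maximum and minimum eigenvalues. Notation: $\xi_{\max}=\lambda_{\max}(\Lambda_1^{-1}A)$, $\xi_{\min}=\lambda_{\min}(\Lambda_1^{-1}A)$, $\eta_{\max}=\lambda_{\max}(\Lambda_2^{-1}B\Lambda_1^{-1}B^T)$, $\eta_{\min}=\lambda_{\min}(\Lambda_2^{-1}B\Lambda_1^{-1}B^T)$, $\theta_{\max}=\lambda_{\max}(\Lambda_2^{-1}C^T\Lambda_3^{-1}C)$. *)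

theory Defs
  imports "HOL-Analysis.Analysis"
begin

definition spd :: "real^'k^'k \<Rightarrow> bool" where
  "spd M \<longleftrightarrow> transpose M = M \<and> (\<forall>x. x \<noteq> 0 \<longrightarrow> x \<bullet> (M *v x) > 0)"

definition eigenvector :: "('a::field)^'k^'k \<Rightarrow> 'a \<Rightarrow> 'a^'k \<Rightarrow> bool" where
  "eigenvector M \<mu> x \<longleftrightarrow> x \<noteq> 0 \<and> M *v x = \<mu> *s x"

definition eigenvalue :: "('a::field)^'k^'k \<Rightarrow> 'a \<Rightarrow> bool" where
  "eigenvalue M \<mu> \<longleftrightarrow> (\<exists>x. eigenvector M \<mu> x)"

abbreviation cmat :: "real^'k^'l \<Rightarrow> complex^'k^'l" where
  "cmat \<equiv> map_matrix complex_of_real"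

lemma eigenvalue_cmat_of_real:
  fixes M :: "real^'k^'k"
  shows "eigenvalue (cmat M) (complex_of_real \<mu>) \<longleftrightarrow> eigenvalue M \<mu>"
proof
  assume "eigenvalue M \<mu>"
  then obtain x where x: "x \<noteq> 0" "M *v x = \<mu> *s x"
    by (auto simp: eigenvalue_def eigenvector_def)
  have "eigenvector (cmat M) (complex_of_real \<mu>) (\<chi> i. complex_of_real (x $ i))"
    using x unfolding eigenvector_def vec_eq_iff matrix_vector_mult_def
    by (simp flip: of_real_mult of_real_sum)
  then show "eigenvalue (cmat M) (complex_of_real \<mu>)"
    by (auto simp: eigenvalue_def)
next
  assume "eigenvalue (cmat M) (complex_of_real \<mu>)"
  then obtain z where z: "z \<noteq> 0"
    and eq: "(\<Sum>j\<in>UNIV. complex_of_real (M $ i $ j) * z $ j) = complex_of_real \<mu> * z $ i" for i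
    by (auto simp: eigenvalue_def eigenvector_def vec_eq_iff matrix_vector_mult_def)
  have re: "M *v (\<chi> i. Re (z $ i)) = \<mu> *s (\<chi> i. Re (z $ i))"
    using arg_cong[OF eq, of Re] by (simp add: vec_eq_iff matrix_vector_mult_def)
  have im: "M *v (\<chi> i. Im (z $ i)) = \<mu> *s (\<chi> i. Im (z $ i))"
    using arg_cong[OF eq, of Im] by (simp add: vec_eq_iff matrix_vector_mult_def)
  have "(\<chi> i. Re (z $ i)) \<noteq> 0 \<or> (\<chi> i. Im (z $ i)) \<noteq> 0"
    using z by (auto simp: vec_eq_iff complex_eq_iff)
  with re im show "eigenvalue M \<mu>"
    by (auto simp: eigenvalue_def eigenvector_def)
qed

text \<open>The next two are only meaningful for matrices all of whose complex eigenvalues are real;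
  by the lemma above, the sets below then contain all of them.\<close>

definition lambda_max :: "real^'k^'k \<Rightarrow> real" where
  "lambda_max M = Max {\<mu>. eigenvalue M \<mu>}"

definition lambda_min :: "real^'k^'k \<Rightarrow> real" where
  "lambda_min M = Min {\<mu>. eigenvalue M \<mu>}"

text \<open>Block vectors and matrices are indexed by the disjoint sum of the index types of the blocks.\<close>

definition block_vec :: "'a^'n \<Rightarrow> 'a^'m \<Rightarrow> 'a^'p \<Rightarrow> 'a^('n + 'm + 'p)" where
  "block_vec u v w = (\<chi> i. case i of
     Inl a \<Rightarrow> u $ a | Inr (Inl b) \<Rightarrow> v $ b | Inr (Inr c) \<Rightarrow> w $ c)"

definition block_mat ::
  "'a^'n^'n \<Rightarrow> 'a^'m^'n \<Rightarrow> 'a^'p^'n \<Rightarrow>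
   'a^'n^'m \<Rightarrow> 'a^'m^'m \<Rightarrow> 'a^'p^'m \<Rightarrow>
   'a^'n^'p \<Rightarrow> 'a^'m^'p \<Rightarrow> 'a^'p^'p \<Rightarrow> 'a^('n + 'm + 'p)^('n + 'm + 'p)" where
  "block_mat M11 M12 M13 M21 M22 M23 M31 M32 M33 = (\<chi> i. case i of
     Inl a \<Rightarrow> block_vec (M11 $ a) (M12 $ a) (M13 $ a)
   | Inr (Inl b) \<Rightarrow> block_vec (M21 $ b) (M22 $ b) (M23 $ b)
   | Inr (Inr c) \<Rightarrow> block_vec (M31 $ c) (M32 $ c) (M33 $ c))"

definition saddle_mat ::
  "real^'n^'n \<Rightarrow> real^'n^'m \<Rightarrow> real^'m^'p \<Rightarrow> real^('n + 'm + 'p)^('n + 'm + 'p)" where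
  "saddle_mat A B C = block_mat
      A   (transpose B) 0
    (- B)      0        (- transpose C)
      0        C        0"

definition Sigma_mat ::
  "real^'n^'n \<Rightarrow> real^'m^'m \<Rightarrow> real^'p^'p \<Rightarrow> real^('n + 'm + 'p)^('n + 'm + 'p)" where
  "Sigma_mat \<Lambda>1 \<Lambda>2 \<Lambda>3 = block_mat \<Lambda>1 0 0  0 \<Lambda>2 0  0 0 \<Lambda>3"

definition P_PESS ::
  "real^'n^'n \<Rightarrow> real^'m^'m \<Rightarrow> real^'p^'p \<Rightarrow> real \<Rightarrow>
   real^'n^'n \<Rightarrow> real^'n^'m \<Rightarrow> real^'m^'p \<Rightarrow> real^('n + 'm + 'p)^('n + 'm + 'p)" where
  "P_PESS \<Lambda>1 \<Lambda>2 \<Lambda>3 s A B C = Sigma_mat \<Lambda>1 \<Lambda>2 \<Lambda>3 + s *\<^sub>R saddle_mat A B C"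

lemma P_PESS_block:
  "P_PESS \<Lambda>1 \<Lambda>2 \<Lambda>3 s A B C = block_mat
     (\<Lambda>1 + s *\<^sub>R A)   (s *\<^sub>R transpose B)  0
     (- (s *\<^sub>R B))     \<Lambda>2                 (- (s *\<^sub>R transpose C))
     0                (s *\<^sub>R C)            \<Lambda>3"
  by (simp add: P_PESS_def Sigma_mat_def saddle_mat_def block_mat_def block_vec_def vec_eq_iff
      split: sum.split)

lemma block_mat_mult_vec:
  fixes M11 :: "'a::semiring_1^'n^'n"
  shows "block_mat M11 M12 M13 M21 M22 M23 M31 M32 M33 *v block_vec u v w =
    block_vec (M11 *v u + M12 *v v + M13 *v w)
              (M21 *v u + M22 *v v + M23 *v w)
              (M31 *v u + M32 *v v + M33 *v w)"
  by (simp add: block_mat_def block_vec_def vec_eq_iff matrix_vector_mult_def UNIV_sum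
      sum.Plus sum.reindex add.assoc Plus_def[symmetric] UNIV_Plus_UNIV[symmetric]
      del: UNIV_Plus_UNIV split: sum.split)

end

(* With t = lam / (1 - s lam) the eigenvalue equation becomes the generalised problem
   saddle_mat p = t Sigma p. Testing its three blocks with u, v, w gives, for
   a = u* \<Lambda>1 u, b = u* A u, d = v* \<Lambda>2 v, f = w* \<Lambda>3 w and Im t \<noteq> 0, the identities
   d = a + f and b = 2 d Re t. The bounds on t follow from these, from Rayleigh quotients
   and from Cauchy-Schwarz in the \<Lambda>-inner products; for the lower bound on Re t, the first
   block, B^T v = (t \<Lambda>1 - A) u, bounds d by a multiple of a. If C v = 0 then w = 0, hence
   f = 0, and the bounds on lam = t / (1 + s t) follow from those on Re t and |t|. *)

theory Submission
  imports Defs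
begin

section \<open>Semidefinite forms and symmetric positive definite matrices\<close>

lemma uminus_matrix_vector_mult: "(- K) *v x = - (K *v x)"
  for K :: "'a::ring_1^'n^'m"
  by (simp add: vec_eq_iff matrix_vector_mult_def sum_negf)

text \<open>The quadratic form is nonnegative on all combinations of \<open>x\<close> and
  \<open>y\<close>. Semidefiniteness suffices, so the inequality also covers degenerate
  forms.\<close>

lemma psd_Cauchy_Schwarz:
  fixes T :: "'a::real_inner \<Rightarrow> 'a"
  assumes lin: "linear T" and sym: "\<And>x y. x \<bullet> T y = y \<bullet> T x" and psd: "\<And>x. 0 \<le> x \<bullet> T x"
  shows "(x \<bullet> T y)\<^sup>2 \<le> (x \<bullet> T x) * (y \<bullet> T y)"
proof -
  interpret linear T by (rule lin)
  have comb: "(r *\<^sub>R x + t *\<^sub>R y) \<bullet> T (r *\<^sub>R x + t *\<^sub>R y)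
      = r\<^sup>2 * (x \<bullet> T x) + 2 * r * t * (x \<bullet> T y) + t\<^sup>2 * (y \<bullet> T y)" for r t
    using sym[of y x]
    by (simp add: add scale inner_add_left inner_add_right power2_eq_square algebra_simps)
  show ?thesis
  proof (cases "y \<bullet> T y = 0")
    case True
    have "x \<bullet> T y = 0"
    proof (rule ccontr)
      assume nz: "x \<bullet> T y \<noteq> 0"
      \<comment> \<open>Since \<open>y\<close> is isotropic, the form at \<open>x + t y\<close> is
        affine in \<open>t\<close>; this choice gives it the negative value
        \<open>- (x \<bullet> T x) - 2\<close>.\<close>
      define t where "t = - (x \<bullet> T x + 1) / (x \<bullet> T y)"
      have t: "t * (x \<bullet> T y) = - (x \<bullet> T x + 1)"
        using nz by (simp add: t_def)
      have "0 \<le> x \<bullet> T x + 2 * (t * (x \<bullet> T y))"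
        using psd[of "1 *\<^sub>R x + t *\<^sub>R y"] unfolding comb[of 1 t] True by simp
      then have "x \<bullet> T x + 2 \<le> 0"
        unfolding t by (simp add: algebra_simps)
      then show False
        using psd[of x] by simp
    qed
    then show ?thesis using True by simp
  next
    case False
    then have pos: "y \<bullet> T y > 0" using psd[of y] by simp
    \<comment> \<open>At \<open>(y \<bullet> T y) x - (x \<bullet> T y) y\<close> the form equals
      \<open>y \<bullet> T y\<close> times the Gram determinant.\<close>
    have "0 \<le> (y \<bullet> T y) * ((x \<bullet> T x) * (y \<bullet> T y) - (x \<bullet> T y)\<^sup>2)"
      using comb[of "y \<bullet> T y" "- (x \<bullet> T y)"] psd[of "(y \<bullet> T y) *\<^sub>R x + (- (x \<bullet> T y)) *\<^sub>R y"]
      by (simp add: power2_eq_square algebra_simps)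
    then show ?thesis using pos by (simp add: zero_le_mult_iff)
  qed
qed

lemma symmetric_inner:
  fixes M :: "real^'k^'k"
  assumes "transpose M = M"
  shows "x \<bullet> (M *v y) = y \<bullet> (M *v x)"
  by (metis assms dot_lmul_matrix inner_commute transpose_matrix_vector)

lemma spd_symmetric: "spd L \<Longrightarrow> transpose L = L"
  by (simp add: spd_def)

lemma spd_nonneg: "spd L \<Longrightarrow> 0 \<le> x \<bullet> (L *v x)"
  by (cases "x = 0") (auto simp: spd_def intro: less_imp_le)

lemma spd_invertible:
  assumes "spd L"
  shows "L ** matrix_inv L = mat 1" "matrix_inv L ** L = mat 1"
proof -
  have "x = 0" if "L *v x = 0" for x
    using assms that by (auto simp: spd_def)
  then have "invertible L"
    by (simp add: invertible_left_inverse matrix_left_invertible_ker)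
  then have "L ** matrix_inv L = mat 1 \<and> matrix_inv L ** L = mat 1"
    unfolding invertible_def matrix_inv_def by (rule someI_ex)
  then show "L ** matrix_inv L = mat 1" "matrix_inv L ** L = mat 1"
    by blast+
qed

lemma spd_inv_symmetric:
  assumes "spd L"
  shows "transpose (matrix_inv L) = matrix_inv L"
proof -
  have "transpose (matrix_inv L) ** L = mat 1"
    using arg_cong[OF spd_invertible(1)[OF assms], of transpose] spd_symmetric[OF assms]
    by (simp add: matrix_transpose_mul transpose_mat)
  then have "transpose (matrix_inv L) ** (L ** matrix_inv L) = matrix_inv L"
    by (simp add: matrix_mul_assoc)
  then show ?thesis by (simp add: spd_invertible[OF assms])
qed

section \<open>Generalised eigenvalues and Rayleigh quotients\<close>

text \<open>Multiplying by \<open>L\<close> removes the inverse: the product \<open>L^-1 M\<close>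
  is in general not symmetric even for symmetric \<open>M\<close>, whereas the pencil
  \<open>M x = \<mu> L x\<close> can be tested with quadratic forms.\<close>

lemma eigenvalue_inv_mult_iff:
  assumes "spd L"
  shows "eigenvalue (matrix_inv L ** M) \<mu> \<longleftrightarrow> (\<exists>x. x \<noteq> 0 \<and> M *v x = \<mu> *\<^sub>R (L *v x))"
proof -
  have "(matrix_inv L ** M) *v x = \<mu> *s x \<longleftrightarrow> M *v x = \<mu> *\<^sub>R (L *v x)" for x
  proof
    assume "(matrix_inv L ** M) *v x = \<mu> *s x"
    then have "L *v ((matrix_inv L ** M) *v x) = L *v (\<mu> *\<^sub>R x)"
      by (simp add: scalar_mult_eq_scaleR)
    then show "M *v x = \<mu> *\<^sub>R (L *v x)"
      by (simp add: matrix_vector_mul_assoc matrix_mul_assoc spd_invertible[OF assms]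
          matrix_vector_mult_scaleR)
  next
    assume "M *v x = \<mu> *\<^sub>R (L *v x)"
    then have "matrix_inv L *v (M *v x) = matrix_inv L *v (L *v (\<mu> *\<^sub>R x))"
      by (simp add: matrix_vector_mult_scaleR)
    then show "(matrix_inv L ** M) *v x = \<mu> *s x"
      by (simp add: matrix_vector_mul_assoc spd_invertible[OF assms] scalar_mult_eq_scaleR)
  qed
  then show ?thesis by (simp add: eigenvalue_def eigenvector_def)
qed

text \<open>Eigenvectors for distinct eigenvalues are orthogonal with respect to \<open>L\<close>, hence independent.\<close>

lemma finite_eigenvalues_inv_mult:
  fixes L M :: "real^'k^'k"
  assumes L: "spd L" and M: "transpose M = M"
  shows "finite {\<mu>. eigenvalue (matrix_inv L ** M) \<mu>}"
proof -
  let ?E = "{\<mu>. eigenvalue (matrix_inv L ** M) \<mu>}"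
  have "\<forall>\<mu>\<in>?E. \<exists>x. x \<noteq> 0 \<and> M *v x = \<mu> *\<^sub>R (L *v x)"
    by (simp add: eigenvalue_inv_mult_iff[OF L])
  then obtain g where g: "\<And>\<mu>. \<mu> \<in> ?E \<Longrightarrow> g \<mu> \<noteq> 0 \<and> M *v g \<mu> = \<mu> *\<^sub>R (L *v g \<mu>)"
    by metis
  have orth: "g \<mu> \<bullet> (L *v g \<nu>) = 0" if "\<mu> \<in> ?E" "\<nu> \<in> ?E" "\<mu> \<noteq> \<nu>" for \<mu> \<nu>
  proof -
    have "\<nu> * (g \<mu> \<bullet> (L *v g \<nu>)) = \<mu> * (g \<mu> \<bullet> (L *v g \<nu>))"
      using symmetric_inner[OF M, of "g \<mu>" "g \<nu>"] g[OF that(1)] g[OF that(2)]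
        symmetric_inner[OF spd_symmetric[OF L], of "g \<mu>" "g \<nu>"] by simp
    then show ?thesis using that(3) by simp
  qed
  have pos: "g \<mu> \<bullet> (L *v g \<mu>) > 0" if "\<mu> \<in> ?E" for \<mu>
    using g[OF that] L by (simp add: spd_def)
  have inj: "inj_on g ?E"
    by (rule inj_onI) (metis orth pos less_irrefl)
  have "independent (g ` ?E)"
    unfolding dependent_def
  proof safe
    fix \<mu> assume \<mu>: "eigenvalue (matrix_inv L ** M) \<mu>" and sp: "g \<mu> \<in> span (g ` ?E - {g \<mu>})"
    have "g ` ?E - {g \<mu>} \<subseteq> {y. y \<bullet> (L *v g \<mu>) = 0}"
      using orth \<mu> by blast
    moreover have "subspace {y. y \<bullet> (L *v g \<mu>) = 0}"
      by (simp add: subspace_def inner_add_left)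
    ultimately have "g \<mu> \<in> {y. y \<bullet> (L *v g \<mu>) = 0}"
      using sp span_minimal by blast
    then show False using pos[of \<mu>] \<mu> by simp
  qed
  then have "finite (g ` ?E)" by (rule independent_imp_finite)
  then show ?thesis using inj by (simp add: finite_image_iff)
qed

text \<open>If \<open>\<mu>\<close> is the maximum of the quotient \<open>x \<bullet> M x / x \<bullet> L x\<close>, attained at \<open>x\<^sub>0\<close>,
  then \<open>\<mu> L - M\<close> is positive semidefinite with \<open>x\<^sub>0\<close> isotropic, hence \<open>x\<^sub>0\<close> is in its kernel.\<close>

lemma Rayleigh_maximum:
  fixes L M :: "real^'k^'k"
  assumes L: "spd L" and M: "transpose M = M"
  obtains \<mu> where "eigenvalue (matrix_inv L ** M) \<mu>" "\<And>x. x \<bullet> (M *v x) \<le> \<mu> * (x \<bullet> (L *v x))"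
proof -
  let ?q = "\<lambda>x. x \<bullet> (M *v x) / (x \<bullet> (L *v x))"
  have pos: "x \<bullet> (L *v x) > 0" if "x \<noteq> 0" for x
    using L that by (simp add: spd_def)
  have "x \<bullet> (L *v x) \<noteq> 0" if "x \<in> sphere 0 1" for x
    using pos[of x] that by force
  moreover have "continuous_on S ((*v) K)" for S and K :: "real^'k^'k"
    by (rule linear_continuous_on) (rule matrix_vector_mul_bounded_linear)
  ultimately have "continuous_on (sphere 0 1) ?q"
    by (intro continuous_on_divide continuous_on_inner continuous_on_id) auto
  moreover have "sphere (0::real^'k) 1 \<noteq> {}" by simp
  ultimately have "\<exists>x0\<in>sphere 0 1. \<forall>y\<in>sphere 0 1. ?q y \<le> ?q x0"
    by (intro continuous_attains_sup compact_sphere)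
  then obtain x0 where x0: "x0 \<in> sphere 0 1" and max: "\<And>y. y \<in> sphere 0 1 \<Longrightarrow> ?q y \<le> ?q x0"
    by blast
  define \<mu> where "\<mu> = ?q x0"
  have le: "x \<bullet> (M *v x) \<le> \<mu> * (x \<bullet> (L *v x))" for x
  proof (cases "x = 0")
    case False
    have "?q x = ?q (x /\<^sub>R norm x)"
      using False by (simp add: matrix_vector_mult_scaleR)
    also have "\<dots> \<le> \<mu>"
      unfolding \<mu>_def by (rule max) (use False in simp)
    finally show ?thesis using pos[OF False] by (simp add: field_simps)
  qed simp
  define N where "N = \<mu> *\<^sub>R L - M"
  have N: "N *v x = \<mu> *\<^sub>R (L *v x) - M *v x" for x
    by (simp add: N_def matrix_vector_mult_diff_rdistrib scaleR_matrix_vector_assoc)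
  have "x0 \<noteq> 0" using x0 by auto
  have iso: "x0 \<bullet> (N *v x0) = 0"
    using pos[OF \<open>x0 \<noteq> 0\<close>] by (simp add: N inner_diff_right \<mu>_def)
  \<comment> \<open>Pairing \<open>x0\<close> with \<open>N x0\<close> bounds the fourth power of
    the norm of \<open>N x0\<close> by a multiple of \<open>x0 \<bullet> N x0 = 0\<close>.\<close>
  have "((N *v x0) \<bullet> (N *v x0))\<^sup>2 \<le> ((N *v x0) \<bullet> (N *v (N *v x0))) * (x0 \<bullet> (N *v x0))"
  proof (rule psd_Cauchy_Schwarz)
    show "x \<bullet> (N *v y) = y \<bullet> (N *v x)" for x y
      using symmetric_inner[OF M, of x y] symmetric_inner[OF spd_symmetric[OF L], of x y]
      by (simp add: N inner_diff_right)
    show "0 \<le> x \<bullet> (N *v x)" for x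
      using le[of x] by (simp add: N inner_diff_right)
  qed simp
  then have "N *v x0 = 0" by (simp add: iso)
  then have "eigenvalue (matrix_inv L ** M) \<mu>"
    using \<open>x0 \<noteq> 0\<close> by (auto simp: eigenvalue_inv_mult_iff[OF L] N)
  then show thesis using le that by blast
qed

text \<open>The maximum of the quotient is an eigenvalue, hence at most \<open>lambda_max\<close>;
  the lower bound is the same fact for \<open>- M\<close>. The set of eigenvalues is finite and
  nonempty, so \<open>Max\<close> and \<open>Min\<close> are genuine.\<close>

lemma
  fixes L M :: "real^'k^'k"
  assumes L: "spd L" and M: "transpose M = M"
  shows le_lambda_max: "x \<bullet> (M *v x) \<le> lambda_max (matrix_inv L ** M) * (x \<bullet> (L *v x))"
    and lambda_min_le: "lambda_min (matrix_inv L ** M) * (x \<bullet> (L *v x)) \<le> x \<bullet> (M *v x)"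
    and eigenvalue_lambda_min: "eigenvalue (matrix_inv L ** M) (lambda_min (matrix_inv L ** M))"
proof -
  let ?E = "{\<mu>. eigenvalue (matrix_inv L ** M) \<mu>}"
  have fin: "finite ?E" using L M by (rule finite_eigenvalues_inv_mult)
  obtain \<mu> where \<mu>: "\<mu> \<in> ?E" "x \<bullet> (M *v x) \<le> \<mu> * (x \<bullet> (L *v x))"
    using Rayleigh_maximum[OF L M] by blast
  have "transpose (- M) = - M"
    using M by (simp add: vec_eq_iff transpose_def)
  then obtain \<nu> where \<nu>: "eigenvalue (matrix_inv L ** (- M)) \<nu>"
      "x \<bullet> ((- M) *v x) \<le> \<nu> * (x \<bullet> (L *v x))"
    using Rayleigh_maximum[OF L] by blast
  have \<nu>E: "- \<nu> \<in> ?E"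
    using \<nu>(1) by (auto simp: eigenvalue_inv_mult_iff[OF L] uminus_matrix_vector_mult) (metis minus_minus)
  have "\<mu> \<le> lambda_max (matrix_inv L ** M)"
    unfolding lambda_max_def using fin \<mu>(1) by (rule Max_ge)
  then show "x \<bullet> (M *v x) \<le> lambda_max (matrix_inv L ** M) * (x \<bullet> (L *v x))"
    using \<mu>(2) mult_right_mono[OF _ spd_nonneg[OF L, of x]] by fastforce
  have "lambda_min (matrix_inv L ** M) \<le> - \<nu>"
    unfolding lambda_min_def using fin \<nu>E by (rule Min_le)
  then have "lambda_min (matrix_inv L ** M) * (x \<bullet> (L *v x)) \<le> - \<nu> * (x \<bullet> (L *v x))"
    by (rule mult_right_mono) (rule spd_nonneg[OF L])
  then show "lambda_min (matrix_inv L ** M) * (x \<bullet> (L *v x)) \<le> x \<bullet> (M *v x)"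
    using \<nu>(2) by (simp add: uminus_matrix_vector_mult)
  show "eigenvalue (matrix_inv L ** M) (lambda_min (matrix_inv L ** M))"
    using Min_in[OF fin] \<mu>(1) unfolding lambda_min_def by auto
qed

text \<open>The pencil equation for the least eigenvalue, tested with its eigenvector, exhibits that
  eigenvalue as a quotient of two positive numbers.\<close>

lemma lambda_min_pos:
  assumes L: "spd L" and M: "spd M"
  shows "0 < lambda_min (matrix_inv L ** M)"
proof -
  obtain x where "x \<noteq> 0" "M *v x = lambda_min (matrix_inv L ** M) *\<^sub>R (L *v x)"
    using eigenvalue_lambda_min[OF L spd_symmetric[OF M]] by (auto simp: eigenvalue_inv_mult_iff[OF L])
  moreover from this have "x \<bullet> (M *v x) > 0" "x \<bullet> (L *v x) > 0"
    using L M by (auto simp: spd_def)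
  ultimately show ?thesis by (simp add: zero_less_mult_iff)
qed

section \<open>Complex vectors as pairs of real vectors\<close>

text \<open>Below, \<open>\<bullet>\<close> on complex vectors is the real inner product \<open>Re (x\<^sup>* y)\<close>;
  the imaginary part of \<open>x\<^sup>* y\<close> is recovered as \<open>(\<i> x) \<bullet> y\<close>.\<close>

definition vRe :: "complex^'k \<Rightarrow> real^'k" where
  "vRe x = (\<chi> i. Re (x $ i))"

definition vIm :: "complex^'k \<Rightarrow> real^'k" where
  "vIm x = (\<chi> i. Im (x $ i))"

lemma vRe_cmat: "vRe (cmat M *v x) = M *v vRe x"
  and vIm_cmat: "vIm (cmat M *v x) = M *v vIm x"
  by (simp_all add: vRe_def vIm_def vec_eq_iff matrix_vector_mult_def)

lemma cvec_eq_iff: "x = y \<longleftrightarrow> vRe x = vRe y \<and> vIm x = vIm y"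
  by (auto simp: vRe_def vIm_def vec_eq_iff complex_eq_iff)

lemma vRe_0 [simp]: "vRe 0 = 0" and vIm_0 [simp]: "vIm 0 = 0"
  by (simp_all add: vRe_def vIm_def vec_eq_iff)

lemma inner_cvec: "x \<bullet> y = vRe x \<bullet> vRe y + vIm x \<bullet> vIm y"
  for x y :: "complex^'k"
  by (simp add: inner_vec_def inner_complex_def vRe_def vIm_def sum.distrib)

lemma inner_cmat: "x \<bullet> (cmat K *v y) = (cmat (transpose K) *v x) \<bullet> y"
  by (simp add: inner_cvec vRe_cmat vIm_cmat dot_lmul_matrix)

lemma cmat_mult: "cmat (K ** M) *v x = cmat K *v (cmat M *v x)"
  by (simp only: cvec_eq_iff vRe_cmat vIm_cmat) (simp add: matrix_vector_mul_assoc)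

lemma cmat_id: "cmat (mat 1) *v x = x"
  by (simp add: cvec_eq_iff vRe_cmat vIm_cmat)

lemma scale_eq_scaleR: "c *s x = Re c *\<^sub>R x + Im c *\<^sub>R (\<i> *s x)"
  for x :: "complex^'k"
  by (simp add: vec_eq_iff complex_eq_iff)

lemma inner_ii: "(\<i> *s x) \<bullet> (\<i> *s y) = x \<bullet> y"
  and inner_ii_left: "(\<i> *s x) \<bullet> y = - (x \<bullet> (\<i> *s y))"
  for x y :: "complex^'k"
  by (simp_all add: inner_vec_def inner_complex_def algebra_simps sum_negf[symmetric])

text \<open>A real symmetric matrix is self-adjoint and commutes with multiplication by
  \<open>\<i>\<close>, which is skew; so \<open>x* M x\<close> has no imaginary part.\<close>

lemma cmat_inner_ii_self:
  assumes "transpose M = M"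
  shows "(\<i> *s x) \<bullet> (cmat M *v x) = 0"
proof -
  have "(\<i> *s x) \<bullet> (cmat M *v x) = (cmat M *v x) \<bullet> (\<i> *s x)"
    by (rule inner_commute)
  also have "\<dots> = x \<bullet> (cmat M *v (\<i> *s x))"
    by (simp add: inner_cmat assms)
  also have "\<dots> = - ((\<i> *s x) \<bullet> (cmat M *v x))"
    by (simp add: inner_ii_left vector_scalar_commute)
  finally show ?thesis by simp
qed

lemma spd_cmat_nonneg: "spd L \<Longrightarrow> 0 \<le> x \<bullet> (cmat L *v x)"
  by (simp add: inner_cvec vRe_cmat vIm_cmat spd_nonneg)

lemma spd_cmat_pos: "spd L \<Longrightarrow> x \<noteq> 0 \<Longrightarrow> 0 < x \<bullet> (cmat L *v x)"
  using spd_nonneg[of L "vRe x"] spd_nonneg[of L "vIm x"]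
  by (auto simp: inner_cvec[of x] vRe_cmat vIm_cmat spd_def cvec_eq_iff[of x]
      intro: add_pos_nonneg add_nonneg_pos)

lemma spd_cmat_Cauchy_Schwarz:
  assumes "spd L"
  shows "(x \<bullet> (cmat L *v y))\<^sup>2 \<le> (x \<bullet> (cmat L *v x)) * (y \<bullet> (cmat L *v y))"
proof (rule psd_Cauchy_Schwarz)
  show "linear ((*v) (cmat L))"
    by (rule linearI) (simp add: matrix_vector_right_distrib,
        simp add: vec_eq_iff matrix_vector_mult_def scaleR_sum_right)
  show "x \<bullet> (cmat L *v y) = y \<bullet> (cmat L *v x)" for x y
    using inner_cmat[of x L y] by (simp add: spd_symmetric[OF assms] inner_commute)
qed (rule spd_cmat_nonneg[OF assms])

text \<open>A real symmetric form at \<open>x\<close> is the sum of its values at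
  \<open>vRe x\<close> and \<open>vIm x\<close>, so the real Rayleigh bounds add up.\<close>

lemma
  assumes "spd L" "transpose M = M"
  shows cmat_le_lambda_max:
      "x \<bullet> (cmat M *v x) \<le> lambda_max (matrix_inv L ** M) * (x \<bullet> (cmat L *v x))"
    and cmat_lambda_min_le:
      "lambda_min (matrix_inv L ** M) * (x \<bullet> (cmat L *v x)) \<le> x \<bullet> (cmat M *v x)"
  using le_lambda_max[OF assms, of "vRe x"] le_lambda_max[OF assms, of "vIm x"]
    lambda_min_le[OF assms, of "vRe x"] lambda_min_le[OF assms, of "vIm x"]
  by (simp_all add: inner_cvec vRe_cmat vIm_cmat algebra_simps)

section \<open>Forms of the shape \<open>K L^-1 K^T\<close>\<close>

lemma schur_symmetric:
  assumes "spd L"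
  shows "transpose (K ** matrix_inv L ** transpose K) = K ** matrix_inv L ** transpose K"
  by (simp add: matrix_transpose_mul spd_inv_symmetric[OF assms] matrix_mul_assoc)

text \<open>The vector \<open>y z\<close> is \<open>L^-1 K^T z\<close>; it turns the form of
  \<open>K L^-1 K^T\<close> into a squared \<open>L\<close>-norm, to which Cauchy-Schwarz
  applies.\<close>

lemma schur_inner:
  fixes K :: "real^'k^'l" and z :: "complex^'l"
  assumes "spd L"
  defines "y \<equiv> \<lambda>z. cmat (matrix_inv L ** transpose K) *v z"
  shows "z \<bullet> (cmat (K ** matrix_inv L ** transpose K) *v z) = y z \<bullet> (cmat L *v y z)"
    and "cmat L *v y z = cmat (transpose K) *v z"
proof -
  show y: "cmat L *v y z = cmat (transpose K) *v z"
    by (simp add: y_def cmat_mult[symmetric] matrix_mul_assoc spd_invertible[OF assms(1)])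
  have "z \<bullet> (cmat (K ** matrix_inv L ** transpose K) *v z) = z \<bullet> (cmat K *v y z)"
    by (simp add: y_def cmat_mult[symmetric] matrix_mul_assoc)
  also have "\<dots> = y z \<bullet> (cmat L *v y z)"
    by (simp only: y inner_cmat[of z] inner_commute)
  finally show "z \<bullet> (cmat (K ** matrix_inv L ** transpose K) *v z) = y z \<bullet> (cmat L *v y z)" .
qed

text \<open>Cauchy-Schwarz in the \<open>L\<close>-inner product for \<open>x\<close> and
  \<open>L^-1 K^T z\<close>, followed by the Rayleigh bound relative to \<open>L'\<close>.\<close>

lemma inner_transpose_bound:
  assumes L: "spd L" and L': "spd L'"
  shows "(x \<bullet> (cmat (transpose K) *v z))\<^sup>2 \<le> (x \<bullet> (cmat L *v x)) *
    (lambda_max (matrix_inv L' ** (K ** matrix_inv L ** transpose K)) * (z \<bullet> (cmat L' *v z)))"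
proof -
  have "(x \<bullet> (cmat (transpose K) *v z))\<^sup>2 \<le> (x \<bullet> (cmat L *v x)) *
      (z \<bullet> (cmat (K ** matrix_inv L ** transpose K) *v z))"
    unfolding schur_inner(1)[OF L, of z K] schur_inner(2)[OF L, of K z, symmetric]
    by (rule spd_cmat_Cauchy_Schwarz[OF L])
  also have "\<dots> \<le> (x \<bullet> (cmat L *v x)) *
    (lambda_max (matrix_inv L' ** (K ** matrix_inv L ** transpose K)) * (z \<bullet> (cmat L' *v z)))"
    by (intro mult_left_mono cmat_le_lambda_max L' schur_symmetric L spd_cmat_nonneg)
  finally show ?thesis .
qed

text \<open>With \<open>y = L^-1 M u\<close>, the left side \<open>?g\<close> is both
  \<open>y* L y\<close> and \<open>y* M u\<close>. Cauchy-Schwarz for \<open>M\<close> and the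
  Rayleigh bound at \<open>y\<close> and at \<open>u\<close> give
  \<open>?g^2 \<le> ?\<xi>^2 ?g ?a\<close>, and one factor \<open>?g\<close> cancels.\<close>

lemma spd_square_bound:
  fixes u :: "complex^'k"
  assumes L: "spd L" and M: "spd M"
  shows "u \<bullet> (cmat (M ** matrix_inv L ** M) *v u)
    \<le> (lambda_max (matrix_inv L ** M))\<^sup>2 * (u \<bullet> (cmat L *v u))" (is "?g \<le> ?\<xi>\<^sup>2 * ?a")
proof -
  define y where "y = cmat (matrix_inv L ** M) *v u"
  have g: "?g = y \<bullet> (cmat L *v y)" and y: "cmat L *v y = cmat M *v u"
    using schur_inner(1)[OF L, of u M] schur_inner(2)[OF L, of M u] by (simp_all add: y_def spd_symmetric[OF M])
  have nn: "0 \<le> ?g" unfolding g by (rule spd_cmat_nonneg[OF L])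
  have up: "x \<bullet> (cmat M *v x) \<le> ?\<xi> * (x \<bullet> (cmat L *v x))" for x :: "complex^'k"
    by (rule cmat_le_lambda_max[OF L spd_symmetric[OF M]])
  have "?g\<^sup>2 = (y \<bullet> (cmat M *v u))\<^sup>2"
    unfolding g y ..
  also have "\<dots> \<le> (y \<bullet> (cmat M *v y)) * (u \<bullet> (cmat M *v u))"
    by (rule spd_cmat_Cauchy_Schwarz[OF M])
  also have "\<dots> \<le> (?\<xi> * ?g) * (?\<xi> * ?a)"
    using up[of y] up[of u] spd_cmat_nonneg[OF M, of y] spd_cmat_nonneg[OF M, of u]
    unfolding g by (intro mult_mono) auto
  finally have *: "?g * ?g \<le> ?g * (?\<xi>\<^sup>2 * ?a)"
    by (simp add: power2_eq_square algebra_simps)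
  show ?thesis
  proof (cases "?g = 0")
    case True
    then show ?thesis using spd_cmat_nonneg[OF L, of u] by simp
  next
    case False
    then show ?thesis using * nn by simp
  qed
qed

lemma cmat_minus: "cmat K *v (- x) = - (cmat K *v x)"
  by (simp add: vec_eq_iff matrix_vector_mult_def sum_negf)

text \<open>Expansion of a squared \<open>L\<close>-norm over the reals, with \<open>c x\<close>
  split along \<open>x\<close> and \<open>\<i> x\<close>; these two are \<open>L\<close>-orthogonal
  of equal length.\<close>

lemma spd_inner_combination:
  assumes "spd L"
  shows "(c *s x + y) \<bullet> (cmat L *v (c *s x + y)) =
    ((Re c)\<^sup>2 + (Im c)\<^sup>2) * (x \<bullet> (cmat L *v x)) +
    2 * (Re c * (y \<bullet> (cmat L *v x)) + Im c * (y \<bullet> (cmat L *v (\<i> *s x)))) + y \<bullet> (cmat L *v y)"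
proof -
  have sym: "a \<bullet> (cmat L *v b) = b \<bullet> (cmat L *v a)" for a b
    using inner_cmat[of a L b] by (simp add: spd_symmetric[OF assms] inner_commute)
  have lin: "cmat L *v (r *\<^sub>R a) = r *\<^sub>R (cmat L *v a)" for r a
    by (simp add: vec_eq_iff matrix_vector_mult_def scaleR_sum_right)
  have ii: "(\<i> *s x) \<bullet> (cmat L *v (\<i> *s x)) = x \<bullet> (cmat L *v x)"
    by (simp only: vector_scalar_commute inner_ii)
  have xi: "x \<bullet> (cmat L *v (\<i> *s x)) = 0"
    using sym[of x "\<i> *s x"] cmat_inner_ii_self[OF spd_symmetric[OF assms], of x] by simp
  show ?thesis
    unfolding scale_eq_scaleR[of c x]
    using sym[of "\<i> *s x" x] sym[of x y] sym[of "\<i> *s x" y] ii xi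
    by (simp add: lin matrix_vector_right_distrib inner_add_left inner_add_right
        power2_eq_square algebra_simps)
qed

section \<open>The three-block eigenvalue problem\<close>

text \<open>The scalar \<open>\<theta>\<close> stands for \<open>lam / (1 - s lam)\<close>, so
  \<open>s\<close> no longer occurs. It is not to be confused with \<open>\<theta>M\<close>, which
  is the \<open>\<theta>max\<close> of the theorem.\<close>

locale saddle_eigenpair =
  fixes A \<Lambda>1 :: "real^'n^'n" and \<Lambda>2 :: "real^'m^'m" and \<Lambda>3 :: "real^'p^'p"
    and B :: "real^'n^'m" and C :: "real^'m^'p"
    and \<theta> :: complex
    and u :: "complex^'n" and v :: "complex^'m" and w :: "complex^'p"
  assumes A: "spd A" and \<Lambda>1: "spd \<Lambda>1" and \<Lambda>2: "spd \<Lambda>2" and \<Lambda>3: "spd \<Lambda>3"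
    and B_rank: "rank B = CARD('m)"
    and eq1: "cmat A *v u + cmat (transpose B) *v v = \<theta> *s (cmat \<Lambda>1 *v u)"
    and eq2: "- (cmat B *v u) - cmat (transpose C) *v w = \<theta> *s (cmat \<Lambda>2 *v v)"
    and eq3: "cmat C *v v = \<theta> *s (cmat \<Lambda>3 *v w)"
    and nontrivial: "u \<noteq> 0 \<or> v \<noteq> 0 \<or> w \<noteq> 0"
    and nonreal: "Im \<theta> \<noteq> 0"
begin

definition "qa = u \<bullet> (cmat \<Lambda>1 *v u)"
definition "qb = u \<bullet> (cmat A *v u)"
definition "qd = v \<bullet> (cmat \<Lambda>2 *v v)"
definition "qf = w \<bullet> (cmat \<Lambda>3 *v w)"

definition "\<xi>M = lambda_max (matrix_inv \<Lambda>1 ** A)"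
definition "\<xi>m = lambda_min (matrix_inv \<Lambda>1 ** A)"
definition "\<eta>M = lambda_max (matrix_inv \<Lambda>2 ** (B ** matrix_inv \<Lambda>1 ** transpose B))"
definition "\<eta>m = lambda_min (matrix_inv \<Lambda>2 ** (B ** matrix_inv \<Lambda>1 ** transpose B))"
definition "\<theta>M = lambda_max (matrix_inv \<Lambda>2 ** (transpose C ** matrix_inv \<Lambda>3 ** C))"

lemma scale_zero_iff: "\<theta> *s x = 0 \<longleftrightarrow> x = 0" for x :: "complex^'k"
  using nonreal by auto

text \<open>Full row rank of \<open>B\<close> means that its transpose is injective; this is applied
  to real and imaginary parts separately.\<close>

lemma transpose_B_inj:
  assumes "cmat (transpose B) *v x = 0"
  shows "x = 0"
proof -
  have "inj ((*v) (transpose B))"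
    using B_rank by (simp only: full_rank_injective[symmetric] rank_transpose)
  moreover have "transpose B *v vRe x = transpose B *v 0" "transpose B *v vIm x = transpose B *v 0"
    using arg_cong[OF assms, of vRe] arg_cong[OF assms, of vIm]
    by (simp_all only: vRe_cmat vIm_cmat vRe_0 vIm_0 matrix_vector_mult_0_right)
  ultimately show ?thesis unfolding cvec_eq_iff vRe_0 vIm_0 by (blast dest: injD)
qed

lemma cmat_spd_zeroD: "spd L \<Longrightarrow> cmat L *v x = 0 \<Longrightarrow> x = 0"
  using spd_cmat_pos[of L x] by fastforce

text \<open>If \<open>u\<close> vanished, the first block would force \<open>v = 0\<close> and then
  the third \<open>w = 0\<close>. This makes \<open>qa\<close> positive, so that it can be cancelled
  later.\<close>

lemma u_nonzero: "u \<noteq> 0"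
proof
  assume u: "u = 0"
  then have v: "v = 0" using eq1 transpose_B_inj by simp
  then have "w = 0" using eq3 scale_zero_iff cmat_spd_zeroD[OF \<Lambda>3] by fastforce
  with u v nontrivial show False by simp
qed

lemma qa_pos: "0 < qa"
  unfolding qa_def using \<Lambda>1 u_nonzero by (rule spd_cmat_pos)

lemma qf_nonneg: "0 \<le> qf"
  unfolding qf_def using \<Lambda>3 by (rule spd_cmat_nonneg)

text \<open>Since \<open>x* L x\<close> is real, the two parts of \<open>\<theta> (x* L x)\<close>
  are those of \<open>\<theta>\<close> times it.\<close>

lemma self_inner:
  assumes "spd L"
  shows "x \<bullet> (\<theta> *s (cmat L *v x)) = Re \<theta> * (x \<bullet> (cmat L *v x))"
    and "(\<i> *s x) \<bullet> (\<theta> *s (cmat L *v x)) = Im \<theta> * (x \<bullet> (cmat L *v x))"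
proof -
  note z = cmat_inner_ii_self[OF spd_symmetric[OF assms], of x]
  then have z': "x \<bullet> (\<i> *s (cmat L *v x)) = 0"
    by (simp add: inner_ii_left)
  show "x \<bullet> (\<theta> *s (cmat L *v x)) = Re \<theta> * (x \<bullet> (cmat L *v x))"
    by (subst scale_eq_scaleR) (simp only: inner_add_right inner_scaleR_right z')
  show "(\<i> *s x) \<bullet> (\<theta> *s (cmat L *v x)) = Im \<theta> * (x \<bullet> (cmat L *v x))"
    by (subst scale_eq_scaleR) (simp only: inner_add_right inner_scaleR_right z inner_ii)
qed

text \<open>The real and imaginary parts of \<open>u\<^sup>* B\<^sup>T v\<close> and \<open>w\<^sup>* C v\<close>,
  obtained by testing the three block equations with \<open>u, v, w\<close> and with \<open>\<i>u, \<i>v, \<i>w\<close>.\<close>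

definition "rX = u \<bullet> (cmat (transpose B) *v v)"
definition "iX = (\<i> *s u) \<bullet> (cmat (transpose B) *v v)"
definition "rZ = w \<bullet> (cmat C *v v)"
definition "iZ = (\<i> *s w) \<bullet> (cmat C *v v)"

lemma tested:
  shows "qb + rX = Re \<theta> * qa" and "iX = Im \<theta> * qa"
    and "- rX - rZ = Re \<theta> * qd" and "iX + iZ = Im \<theta> * qd"
    and "rZ = Re \<theta> * qf" and "iZ = Im \<theta> * qf"
proof -
  show "qb + rX = Re \<theta> * qa"
    using arg_cong[OF eq1, of "inner u"] self_inner[OF \<Lambda>1, of u]
    by (simp add: qa_def qb_def rX_def inner_add_right)
  show "iX = Im \<theta> * qa"
    using arg_cong[OF eq1, of "inner (\<i> *s u)"] self_inner[OF \<Lambda>1, of u]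
      cmat_inner_ii_self[OF spd_symmetric[OF A], of u]
    by (simp add: qa_def iX_def inner_add_right)
  show "rZ = Re \<theta> * qf" "iZ = Im \<theta> * qf"
    using arg_cong[OF eq3, of "inner w"] arg_cong[OF eq3, of "inner (\<i> *s w)"]
      self_inner[OF \<Lambda>3, of w]
    by (simp_all add: qf_def rZ_def iZ_def)
  have "v \<bullet> (cmat B *v u) = rX" "v \<bullet> (cmat (transpose C) *v w) = rZ"
    unfolding rX_def rZ_def
    by (simp_all only: inner_cmat[of v] transpose_transpose inner_commute)
  \<comment> \<open>Swapping the two sides of a pairing conjugates it, which flips the sign of the
    imaginary part only.\<close>
  moreover have "(\<i> *s v) \<bullet> (cmat B *v u) = - iX"
    "(\<i> *s v) \<bullet> (cmat (transpose C) *v w) = - iZ"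
    unfolding iX_def iZ_def
    by (simp_all only: inner_cmat[of "\<i> *s v"] inner_ii_left[of u] inner_ii_left[of w]
        transpose_transpose vector_scalar_commute minus_minus inner_commute)
  ultimately show "- rX - rZ = Re \<theta> * qd" "iX + iZ = Im \<theta> * qd"
    using arg_cong[OF eq2, of "inner v"] arg_cong[OF eq2, of "inner (\<i> *s v)"]
      self_inner[OF \<Lambda>2, of v]
    by (simp_all add: qd_def inner_diff_right)
qed

text \<open>Comparison of the imaginary parts of the tested equations;
  \<open>Im \<theta> \<noteq> 0\<close> allows cancellation.\<close>

lemma qd_eq: "qd = qa + qf"
proof -
  have "Im \<theta> * qd = Im \<theta> * (qa + qf)"
    using tested by (simp add: distrib_left)
  then show ?thesis using nonreal by simp
qed

text \<open>Eliminating \<open>rX\<close> and \<open>rZ\<close> from the real parts gives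
  \<open>qb = Re \<theta> (qa + qd + qf)\<close>, and \<open>qa + qf = qd\<close>.\<close>

lemma qb_eq: "qb = 2 * Re \<theta> * qd"
  using tested qd_eq by (simp add: algebra_simps)

lemma qd_pos: "0 < qd"
  using qd_eq qa_pos qf_nonneg by simp

lemma qb_bounds: "\<xi>m * qa \<le> qb" "qb \<le> \<xi>M * qa"
  unfolding qa_def qb_def \<xi>m_def \<xi>M_def
  by (intro cmat_le_lambda_max cmat_lambda_min_le \<Lambda>1 spd_symmetric A)+

lemma \<xi>m_pos: "0 < \<xi>m"
  unfolding \<xi>m_def using \<Lambda>1 A by (rule lambda_min_pos)

section \<open>Bounds on the real and imaginary parts of \<open>\<theta>\<close>\<close>

lemma B_bound: "(x \<bullet> (cmat (transpose B) *v v))\<^sup>2 \<le> (x \<bullet> (cmat \<Lambda>1 *v x)) * (\<eta>M * qd)"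
  unfolding \<eta>M_def qd_def by (rule inner_transpose_bound[OF \<Lambda>1 \<Lambda>2])

lemma C_bound: "(x \<bullet> (cmat C *v v))\<^sup>2 \<le> (x \<bullet> (cmat \<Lambda>3 *v x)) * (\<theta>M * qd)"
  using inner_transpose_bound[OF \<Lambda>3 \<Lambda>2, of x "transpose C" v]
  by (simp add: \<theta>M_def qd_def)

text \<open>\<open>B_bound\<close> at \<open>\<i> u\<close> bounds \<open>iX^2\<close>, where
  \<open>iX = Im \<theta> qa\<close>; a factor \<open>qa\<close> cancels.\<close>

lemma Im_bound_B: "(Im \<theta>)\<^sup>2 * qa \<le> \<eta>M * qd"
proof -
  have "qa * ((Im \<theta>)\<^sup>2 * qa) \<le> qa * (\<eta>M * qd)"
    using B_bound[of "\<i> *s u"] tested(2)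
    by (simp add: iX_def vector_scalar_commute inner_ii qa_def[symmetric] power2_eq_square
        algebra_simps)
  then show ?thesis using qa_pos by simp
qed

lemma \<eta>M_nonneg: "0 \<le> \<eta>M"
proof -
  have "0 \<le> (Im \<theta>)\<^sup>2 * qa" using qa_pos by simp
  then have "0 \<le> \<eta>M * qd" using Im_bound_B by linarith
  then show ?thesis using qd_pos by (simp add: zero_le_mult_iff)
qed

lemma \<theta>M_nonneg: "0 \<le> \<theta>M"
proof -
  have "0 \<le> v \<bullet> (cmat (transpose C ** matrix_inv \<Lambda>3 ** C) *v v)"
    using schur_inner(1)[OF \<Lambda>3, of v "transpose C"] spd_cmat_nonneg[OF \<Lambda>3]
    unfolding transpose_transpose by metis
  also have "\<dots> \<le> \<theta>M * qd"
    using cmat_le_lambda_max[OF \<Lambda>2 schur_symmetric[OF \<Lambda>3, of "transpose C"], of v]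
    by (simp add: \<theta>M_def qd_def)
  finally show ?thesis using qd_pos by (simp add: zero_le_mult_iff)
qed

lemma Im_bound_C: "(Im \<theta>)\<^sup>2 * qf \<le> \<theta>M * qd"
proof (cases "qf = 0")
  \<comment> \<open>Here \<open>w\<close> may be zero, so \<open>qf\<close> cannot be cancelled as
    \<open>qa\<close> was.\<close>
  case True
  then show ?thesis using \<theta>M_nonneg qd_pos by simp
next
  case False
  then have "0 < qf" using qf_nonneg by simp
  moreover have "qf * ((Im \<theta>)\<^sup>2 * qf) \<le> qf * (\<theta>M * qd)"
    using C_bound[of "\<i> *s w"] tested(6)
    by (simp add: iZ_def vector_scalar_commute inner_ii qf_def[symmetric] power2_eq_square
        algebra_simps)
  ultimately show ?thesis by simp
qed

text \<open>The bounds from \<open>B\<close> and \<open>C\<close> add up because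
  \<open>qa + qf = qd\<close>.\<close>

lemma Im_bound: "(Im \<theta>)\<^sup>2 \<le> \<eta>M + \<theta>M"
proof -
  have "(Im \<theta>)\<^sup>2 * qd \<le> (\<eta>M + \<theta>M) * qd"
    using Im_bound_B Im_bound_C by (simp add: qd_eq algebra_simps)
  then show ?thesis using qd_pos by simp
qed

lemma Re_pos: "0 < Re \<theta>"
proof -
  have "0 < qb" using qb_bounds(1) mult_pos_pos[OF \<xi>m_pos qa_pos] by linarith
  then show ?thesis using qd_pos by (simp add: qb_eq zero_less_mult_iff)
qed

lemma Re_upper: "Re \<theta> \<le> \<xi>M / 2"
proof -
  have "2 * Re \<theta> * qa \<le> 2 * Re \<theta> * qd"
    using Re_pos qf_nonneg by (simp add: qd_eq)
  also have "\<dots> \<le> \<xi>M * qa"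
    using qb_bounds(2) by (simp add: qb_eq)
  finally show ?thesis using qa_pos by simp
qed

text \<open>The first block reads \<open>y = \<theta> u - g\<close> with
  \<open>y = \<Lambda>1^-1 B^T v\<close> and \<open>g = \<Lambda>1^-1 A u\<close>. The squared
  \<open>\<Lambda>1\<close>-norm of \<open>y\<close> is at least \<open>\<eta>m qd\<close>, and
  expanding the right side bounds it by a multiple of \<open>qa\<close>.\<close>

lemma qd_upper: "\<eta>m * qd \<le> (\<xi>M\<^sup>2 + \<eta>M + \<theta>M) * qa"
proof -
  define y where "y = cmat (matrix_inv \<Lambda>1 ** transpose B) *v v"
  define g where "g = cmat (matrix_inv \<Lambda>1 ** A) *v u"
  have y: "v \<bullet> (cmat (B ** matrix_inv \<Lambda>1 ** transpose B) *v v) = y \<bullet> (cmat \<Lambda>1 *v y)"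
    "cmat \<Lambda>1 *v y = cmat (transpose B) *v v"
    unfolding y_def by (rule schur_inner[OF \<Lambda>1])+
  have g: "u \<bullet> (cmat (A ** matrix_inv \<Lambda>1 ** A) *v u) = g \<bullet> (cmat \<Lambda>1 *v g)"
    "cmat \<Lambda>1 *v g = cmat A *v u"
    unfolding g_def using schur_inner(1)[OF \<Lambda>1, of u A] schur_inner(2)[OF \<Lambda>1, of A u] by (simp_all add: spd_symmetric[OF A])
  have "cmat \<Lambda>1 *v (y - (\<theta> *s u - g)) = 0"
    using eq1 by (simp add: y(2) g(2) matrix_vector_mult_diff_distrib vector_scalar_commute algebra_simps)
  then have y': "y = \<theta> *s u - g"
    using cmat_spd_zeroD[OF \<Lambda>1] by fastforce
  have gu: "g \<bullet> (cmat \<Lambda>1 *v u) = qb" "g \<bullet> (cmat \<Lambda>1 *v (\<i> *s u)) = 0"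
    using cmat_inner_ii_self[OF spd_symmetric[OF A], of u]
    by (simp_all only: inner_cmat[of g] spd_symmetric[OF \<Lambda>1] g(2) qb_def inner_commute)
  have "y \<bullet> (cmat \<Lambda>1 *v y)
      = (Re \<theta>)\<^sup>2 * qa + (Im \<theta>)\<^sup>2 * qa - 2 * Re \<theta> * qb + g \<bullet> (cmat \<Lambda>1 *v g)"
    using spd_inner_combination[OF \<Lambda>1, of \<theta> u "- g"] gu
    by (simp add: y' qa_def cmat_minus algebra_simps)
  \<comment> \<open>Substituting \<open>qb = 2 Re \<theta> qd\<close> collects all terms in
    \<open>Re \<theta>\<close> into one that is nonpositive, as \<open>qa \<le> qd\<close>; only
    \<open>Im \<theta>\<close> and \<open>g\<close> remain to be estimated.\<close>
  also have "\<dots> = (Re \<theta>)\<^sup>2 * (qa - 4 * qd) + (Im \<theta>)\<^sup>2 * qa + g \<bullet> (cmat \<Lambda>1 *v g)"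
    by (simp add: qb_eq power2_eq_square algebra_simps)
  also have "\<dots> \<le> 0 + (\<eta>M + \<theta>M) * qa + \<xi>M\<^sup>2 * qa"
  proof (intro add_mono)
    show "(Re \<theta>)\<^sup>2 * (qa - 4 * qd) \<le> 0"
      using qa_pos qf_nonneg by (simp add: qd_eq mult_nonneg_nonpos)
    show "(Im \<theta>)\<^sup>2 * qa \<le> (\<eta>M + \<theta>M) * qa"
      using Im_bound qa_pos by simp
    show "g \<bullet> (cmat \<Lambda>1 *v g) \<le> \<xi>M\<^sup>2 * qa"
      using spd_square_bound[OF \<Lambda>1 A, of u] unfolding g(1) \<xi>M_def qa_def .
  qed
  finally have "y \<bullet> (cmat \<Lambda>1 *v y) \<le> (\<xi>M\<^sup>2 + \<eta>M + \<theta>M) * qa"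
    by (simp add: algebra_simps)
  moreover have "\<eta>m * qd \<le> y \<bullet> (cmat \<Lambda>1 *v y)"
    unfolding \<eta>m_def qd_def y(1)[symmetric]
    by (rule cmat_lambda_min_le[OF \<Lambda>2 schur_symmetric[OF \<Lambda>1]])
  ultimately show ?thesis by linarith
qed

text \<open>The chain is \<open>\<xi>m \<eta>m qd \<le> \<xi>m k qa \<le> k qb = 2 k Re \<theta>
  qd\<close>, with \<open>qd > 0\<close> cancelled.\<close>

lemma Re_lower: "\<xi>m * \<eta>m / (2 * (\<xi>M\<^sup>2 + \<eta>M + \<theta>M)) \<le> Re \<theta>"
proof -
  define k where "k = \<xi>M\<^sup>2 + \<eta>M + \<theta>M"
  have "0 < \<xi>M" using Re_upper Re_pos by linarith
  then have k: "0 < k"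
    unfolding k_def using \<eta>M_nonneg \<theta>M_nonneg by (simp add: add_pos_nonneg)
  have "\<xi>m * (\<eta>m * qd) \<le> \<xi>m * (k * qa)"
    using qd_upper \<xi>m_pos by (simp add: k_def)
  also have "\<dots> \<le> k * qb"
    using mult_left_mono[OF qb_bounds(1) less_imp_le[OF k]] by (simp add: algebra_simps)
  finally have "\<xi>m * \<eta>m * qd \<le> (2 * k * Re \<theta>) * qd"
    by (simp add: qb_eq algebra_simps)
  then have "\<xi>m * \<eta>m \<le> 2 * k * Re \<theta>"
    using qd_pos by simp
  then show ?thesis
    using k unfolding k_def[symmetric] by (simp add: divide_le_eq algebra_simps)
qed

lemma
  assumes "cmat C *v v = 0"
  shows kernel_Re_lower: "\<xi>m / 2 \<le> Re \<theta>"
    and kernel_norm_upper: "(cmod \<theta>)\<^sup>2 \<le> \<eta>M"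
proof -
  have "w = 0"
    using assms eq3 scale_zero_iff cmat_spd_zeroD[OF \<Lambda>3] by metis
  then have qf: "qf = 0" and rZ: "rZ = 0"
    unfolding qf_def rZ_def by simp_all
  have "\<xi>m * qa \<le> 2 * Re \<theta> * qa"
    using qb_bounds(1) by (simp add: qb_eq qd_eq qf)
  then show "\<xi>m / 2 \<le> Re \<theta>" using qa_pos by simp
  have rX: "rX = - Re \<theta> * qa"
    using tested(3) by (simp add: rZ qd_eq qf)
  define r where "r = (cmod \<theta>)\<^sup>2"
  have r: "r = (Re \<theta>)\<^sup>2 + (Im \<theta>)\<^sup>2" by (simp add: r_def cmod_power2)
  \<comment> \<open>As \<open>qf = 0\<close>, the tested equations say
    \<open>u* B^T v = - cnj \<theta> qa\<close>. This multiple of \<open>u\<close> makes the pairing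
    with \<open>B^T v\<close> real, equal to \<open>|\<theta>|^2 qa\<close>, so the real inner
    product captures all of it.\<close>
  define q where "q = (- cnj \<theta>) *s u"
  have q: "q = (- Re \<theta>) *\<^sub>R u + Im \<theta> *\<^sub>R (\<i> *s u)"
    unfolding q_def by (subst scale_eq_scaleR) simp
  have 1: "q \<bullet> (cmat (transpose B) *v v) = r * qa"
    using tested(2) rX unfolding rX_def iX_def
    by (simp add: q r inner_add_left power2_eq_square algebra_simps)
  have 2: "q \<bullet> (cmat \<Lambda>1 *v q) = r * qa"
    using spd_inner_combination[OF \<Lambda>1, of "- cnj \<theta>" u 0] by (simp add: q_def r qa_def)
  have "(r * qa)\<^sup>2 \<le> (r * qa) * (\<eta>M * qa)"
    using B_bound[of q] unfolding 1 2 by (simp add: qd_eq qf)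
  moreover have "0 < r" using nonreal by (auto simp: r_def)
  ultimately have "r \<le> \<eta>M"
    using qa_pos by (simp add: power2_eq_square)
  then show "(cmod \<theta>)\<^sup>2 \<le> \<eta>M" by (simp add: r_def)
qed

end

section \<open>Block form of the preconditioned problem\<close>

lemma block_vec_eq_iff:
  "block_vec u v w = block_vec u' v' w' \<longleftrightarrow> u = u' \<and> v = v' \<and> w = w'"
proof
  assume eq: "block_vec u v w = block_vec u' v' w'"
  have "u $ a = u' $ a" "v $ b = v' $ b" "w $ c = w' $ c" for a b c
    using arg_cong[OF eq, of "\<lambda>x. x $ Inl a"] arg_cong[OF eq, of "\<lambda>x. x $ Inr (Inl b)"]
      arg_cong[OF eq, of "\<lambda>x. x $ Inr (Inr c)"]
    by (simp_all add: block_vec_def)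
  then show "u = u' \<and> v = v' \<and> w = w'" by (simp add: vec_eq_iff)
qed simp

lemma block_vec_cases:
  obtains u v w where "x = block_vec u v w"
proof
  show "x = block_vec (\<chi> a. x $ Inl a) (\<chi> b. x $ Inr (Inl b)) (\<chi> c. x $ Inr (Inr c))"
    by (simp add: block_vec_def vec_eq_iff split: sum.split)
qed

lemma block_vec_0: "block_vec 0 0 0 = 0"
  by (simp add: block_vec_def vec_eq_iff split: sum.split)

lemma scale_block_vec: "c *s block_vec u v w = block_vec (c *s u) (c *s v) (c *s w)"
  by (simp add: block_vec_def vec_eq_iff split: sum.split)

lemma cmat_block_mat:
  "cmat (block_mat M11 M12 M13 M21 M22 M23 M31 M32 M33) =
    block_mat (cmat M11) (cmat M12) (cmat M13) (cmat M21) (cmat M22) (cmat M23)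
      (cmat M31) (cmat M32) (cmat M33)"
  by (simp add: block_mat_def block_vec_def vec_eq_iff split: sum.split)

lemma cmat_0: "cmat 0 = 0" and cmat_uminus: "cmat (- K) = - cmat K"
  by (simp_all add: vec_eq_iff)

lemma cmat_saddle_mult:
  "cmat (saddle_mat A B C) *v block_vec u v w = block_vec
    (cmat A *v u + cmat (transpose B) *v v) (- (cmat B *v u) - cmat (transpose C) *v w) (cmat C *v v)"
  by (simp add: saddle_mat_def cmat_block_mat block_mat_mult_vec cmat_0 cmat_uminus uminus_matrix_vector_mult)

lemma cmat_Sigma_mult:
  "cmat (Sigma_mat \<Lambda>1 \<Lambda>2 \<Lambda>3) *v block_vec u v w =
    block_vec (cmat \<Lambda>1 *v u) (cmat \<Lambda>2 *v v) (cmat \<Lambda>3 *v w)"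
  by (simp add: Sigma_mat_def cmat_block_mat block_mat_mult_vec cmat_0)

lemma cmat_P_PESS_mult:
  "cmat (P_PESS \<Lambda>1 \<Lambda>2 \<Lambda>3 s A B C) *v x =
    cmat (Sigma_mat \<Lambda>1 \<Lambda>2 \<Lambda>3) *v x + complex_of_real s *s (cmat (saddle_mat A B C) *v x)"
  by (simp add: P_PESS_def vec_eq_iff matrix_vector_mult_def sum.distrib sum_distrib_left algebra_simps)

text \<open>The skew-symmetric off-diagonal part does not contribute to \<open>x \<bullet> P x\<close>.\<close>

lemma P_PESS_right_inverse:
  fixes B :: "real^'n^'m" and C :: "real^'m^'p"
  assumes \<Lambda>1: "spd \<Lambda>1" and \<Lambda>2: "spd \<Lambda>2" and \<Lambda>3: "spd \<Lambda>3" and A: "spd A" and s: "s > 0"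
  defines "P \<equiv> P_PESS \<Lambda>1 \<Lambda>2 \<Lambda>3 s A B C"
  shows "P ** matrix_inv P = mat 1"
proof -
  have "x = 0" if "P *v x = 0" for x
  proof -
    obtain u v w where x: "x = block_vec u v w" by (rule block_vec_cases)
    have "block_vec ((\<Lambda>1 + s *\<^sub>R A) *v u + (s *\<^sub>R transpose B) *v v + 0 *v w)
        ((- (s *\<^sub>R B)) *v u + \<Lambda>2 *v v + (- (s *\<^sub>R transpose C)) *v w)
        (0 *v u + (s *\<^sub>R C) *v v + \<Lambda>3 *v w) = block_vec 0 0 0"
      using that unfolding P_def x P_PESS_block block_mat_mult_vec block_vec_0 .
    then have eqs: "\<Lambda>1 *v u + s *\<^sub>R (A *v u) + s *\<^sub>R (transpose B *v v) = 0"
        "- (s *\<^sub>R (B *v u)) + \<Lambda>2 *v v - s *\<^sub>R (transpose C *v w) = 0"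
        "s *\<^sub>R (C *v v) + \<Lambda>3 *v w = 0"
      by (simp_all add: block_vec_eq_iff matrix_vector_mult_add_rdistrib uminus_matrix_vector_mult
          scaleR_matrix_vector_assoc[symmetric])
    have sk: "u \<bullet> (transpose B *v v) = v \<bullet> (B *v u)" "v \<bullet> (transpose C *v w) = w \<bullet> (C *v v)"
      by (metis dot_lmul_matrix inner_commute transpose_matrix_vector)+
    have "u \<bullet> (\<Lambda>1 *v u) + s * (u \<bullet> (A *v u)) + s * (v \<bullet> (B *v u)) = 0"
      "- (s * (v \<bullet> (B *v u))) + v \<bullet> (\<Lambda>2 *v v) - s * (w \<bullet> (C *v v)) = 0"
      "s * (w \<bullet> (C *v v)) + w \<bullet> (\<Lambda>3 *v w) = 0"
      using arg_cong[OF eqs(1), of "inner u"] arg_cong[OF eqs(2), of "inner v"]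
        arg_cong[OF eqs(3), of "inner w"]
      unfolding inner_add_right inner_diff_right inner_minus_right inner_scaleR_right inner_zero_right sk
      by blast+
    then have "u \<bullet> (\<Lambda>1 *v u) + s * (u \<bullet> (A *v u)) + v \<bullet> (\<Lambda>2 *v v) + w \<bullet> (\<Lambda>3 *v w) = 0"
      by linarith
    moreover have "0 \<le> s * (u \<bullet> (A *v u))" using s spd_nonneg[OF A, of u] by simp
    ultimately have "u \<bullet> (\<Lambda>1 *v u) \<le> 0" "v \<bullet> (\<Lambda>2 *v v) \<le> 0" "w \<bullet> (\<Lambda>3 *v w) \<le> 0"
      using spd_nonneg[OF \<Lambda>1, of u] spd_nonneg[OF \<Lambda>2, of v] spd_nonneg[OF \<Lambda>3, of w] by linarith+
    then have "u = 0" "v = 0" "w = 0"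
      using \<Lambda>1 \<Lambda>2 \<Lambda>3 unfolding spd_def by (meson not_le)+
    then show "x = 0" by (simp add: x block_vec_0)
  qed
  then have "invertible P"
    by (simp add: invertible_left_inverse matrix_left_invertible_ker)
  then have "P ** matrix_inv P = mat 1 \<and> matrix_inv P ** P = mat 1"
    unfolding invertible_def matrix_inv_def by (rule someI_ex)
  then show ?thesis by blast
qed

section \<open>The Moebius substitution and the return to \<open>lam\<close>\<close>

text \<open>A Moebius map with real coefficients cannot send a non-real number to a real
  \<open>t\<close>: the imaginary part of \<open>z (1 + t s) = t\<close> gives
  \<open>1 + t s = 0\<close>, its real part then \<open>t = 0\<close>, a contradiction.\<close>

lemma Im_Moebius:
  assumes "Im z \<noteq> 0"
  shows "1 - complex_of_real s * z \<noteq> 0" and "Im (z / (1 - complex_of_real s * z)) \<noteq> 0"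
proof -
  show nz: "1 - complex_of_real s * z \<noteq> 0"
    using assms by (cases "s = 0") (auto simp: complex_eq_iff)
  show "Im (z / (1 - complex_of_real s * z)) \<noteq> 0"
  proof
    assume "Im (z / (1 - complex_of_real s * z)) = 0"
    then obtain t where "z / (1 - complex_of_real s * z) = complex_of_real t"
      by (metis complex_is_Real_iff Reals_cases)
    then have "z = complex_of_real t * (1 - complex_of_real s * z)"
      using nz by (simp add: field_simps)
    then have z: "z * complex_of_real (1 + t * s) = complex_of_real t"
      unfolding of_real_add of_real_mult of_real_1 by algebra
    have "Im z * (1 + t * s) = 0" "Re z * (1 + t * s) = t"
      using arg_cong[OF z, of Im] arg_cong[OF z, of Re]
      by (simp_all only: Im_complex_of_real Re_complex_of_real
          times_complex.sel mult_zero_right diff_zero add_0_left)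
    then show False using assms by auto
  qed
qed

text \<open>Multiplying the eigenvalue equation by \<open>P\<close>, which is
  \<open>Sigma_mat\<close> plus \<open>s\<close> times \<open>saddle_mat\<close>, yields
  \<open>(1 - s lam) S = lam G\<close>; division and comparison of blocks give the locale's
  equations.\<close>

lemma P_PESS_saddle_eigenpair:
  assumes "spd \<Lambda>1" "spd \<Lambda>2" "spd \<Lambda>3" "spd A" "rank B = CARD('m)" "s > 0"
    and eig: "eigenvector (cmat (matrix_inv (P_PESS \<Lambda>1 \<Lambda>2 \<Lambda>3 s A B C) ** saddle_mat A B C))
           lam (block_vec u v w)"
    and Im: "Im lam \<noteq> 0"
  shows "saddle_eigenpair A \<Lambda>1 \<Lambda>2 \<Lambda>3 (B :: real^'n^'m) C (lam / (1 - complex_of_real s * lam)) u v w"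
proof -
  define P where "P = P_PESS \<Lambda>1 \<Lambda>2 \<Lambda>3 s A B C"
  define S where "S = cmat (saddle_mat A B C) *v block_vec u v w"
  define G where "G = cmat (Sigma_mat \<Lambda>1 \<Lambda>2 \<Lambda>3) *v block_vec u v w"
  note nz = Im_Moebius(1)[OF Im, of s]
  have ev: "cmat (matrix_inv P ** saddle_mat A B C) *v block_vec u v w = lam *s block_vec u v w"
    and ne: "block_vec u v w \<noteq> 0"
    using eig by (simp_all add: eigenvector_def P_def)
  have "S = cmat (P ** matrix_inv P) *v S"
    using P_PESS_right_inverse[OF assms(1-4,6)] by (simp add: P_def cmat_id)
  also have "\<dots> = cmat P *v (cmat (matrix_inv P ** saddle_mat A B C) *v block_vec u v w)"
    by (simp only: cmat_mult S_def)
  also have "\<dots> = lam *s (G + complex_of_real s *s S)"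
    unfolding ev vector_scalar_commute unfolding P_def cmat_P_PESS_mult G_def S_def ..
  finally have "(1 - complex_of_real s * lam) *s S = lam *s G"
    by (simp add: vec_eq_iff algebra_simps)
  then have "S = (lam / (1 - complex_of_real s * lam)) *s G"
    using nz by (simp add: vec_eq_iff field_simps)
  then have "block_vec
      (cmat A *v u + cmat (transpose B) *v v) (- (cmat B *v u) - cmat (transpose C) *v w) (cmat C *v v)
      = (lam / (1 - complex_of_real s * lam)) *s
        block_vec (cmat \<Lambda>1 *v u) (cmat \<Lambda>2 *v v) (cmat \<Lambda>3 *v w)"
    unfolding S_def G_def cmat_saddle_mult cmat_Sigma_mult .
  then show ?thesis
    unfolding scale_block_vec block_vec_eq_iff saddle_eigenpair_def
    using assms(1-5) ne Im_Moebius(2)[OF Im, of s] block_vec_0 by metis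
qed

theorem theorem4p3:
  fixes A \<Lambda>1 :: "real^'n^'n" and \<Lambda>2 :: "real^'m^'m" and \<Lambda>3 :: "real^'p^'p"
    and B :: "real^'n^'m" and C :: "real^'m^'p"
    and s \<xi>max \<xi>min \<eta>max \<eta>min \<theta>max :: real
    and lam :: complex
    and u :: "complex^'n" and v :: "complex^'m" and w :: "complex^'p"
  assumes "spd \<Lambda>1" and "spd \<Lambda>2" and "spd \<Lambda>3"
    and "spd A" and "rank B = CARD('m)" and "rank C = CARD('p)" and "s > 0"
    and "\<xi>max = lambda_max (matrix_inv \<Lambda>1 ** A)"
    and "\<xi>min = lambda_min (matrix_inv \<Lambda>1 ** A)"
    and "\<eta>max = lambda_max (matrix_inv \<Lambda>2 ** B ** matrix_inv \<Lambda>1 ** transpose B)"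
    and "\<eta>min = lambda_min (matrix_inv \<Lambda>2 ** B ** matrix_inv \<Lambda>1 ** transpose B)"
    and "\<theta>max = lambda_max (matrix_inv \<Lambda>2 ** transpose C ** matrix_inv \<Lambda>3 ** C)"
    and "eigenvector (cmat (matrix_inv (P_PESS \<Lambda>1 \<Lambda>2 \<Lambda>3 s A B C) ** saddle_mat A B C))
           lam (block_vec u v w)"
    and "Im lam \<noteq> 0"
  shows
    "(cmat C *v v = 0 \<longrightarrow>
        \<xi>min / (2 + s * \<xi>min) \<le> cmod lam \<and>
        cmod lam \<le> sqrt (\<eta>max / (1 + s * \<xi>min + s\<^sup>2 * \<eta>max))) \<and>
     (cmat C *v v \<noteq> 0 \<longrightarrow>
        \<xi>min * \<eta>min / (2 * (\<xi>max\<^sup>2 + \<eta>max + \<theta>max)) \<le> Re (lam / (1 - complex_of_real s * lam)) \<and>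
        Re (lam / (1 - complex_of_real s * lam)) \<le> \<xi>max / 2 \<and>
        \<bar>Im (lam / (1 - complex_of_real s * lam))\<bar> \<le> sqrt (\<eta>max + \<theta>max))"
proof -
  define t where "t = lam / (1 - complex_of_real s * lam)"
  interpret saddle_eigenpair A \<Lambda>1 \<Lambda>2 \<Lambda>3 B C t u v w
    unfolding t_def by (rule P_PESS_saddle_eigenpair) fact+
  have names: "\<xi>max = \<xi>M" "\<xi>min = \<xi>m" "\<eta>max = \<eta>M" "\<eta>min = \<eta>m" "\<theta>max = \<theta>M"
    unfolding assms(8-12) \<xi>M_def \<xi>m_def \<eta>M_def \<eta>m_def \<theta>M_def matrix_mul_assoc by (rule refl)+
  have s: "s > 0" by fact
  have case1: "\<xi>m / (2 + s * \<xi>m) \<le> cmod lam \<and> cmod lam \<le> sqrt (\<eta>M / (1 + s * \<xi>m + s\<^sup>2 * \<eta>M))"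
    if C0: "cmat C *v v = 0"
  proof -
    define r where "r = cmod t"
    define x where "x = Re t"
    have x: "\<xi>m \<le> 2 * x" "x \<le> r"
      using kernel_Re_lower[OF C0] complex_Re_le_cmod[of t] by (simp_all add: r_def x_def)
    have "0 < r" using x \<xi>m_pos by linarith
    moreover have "r\<^sup>2 \<le> \<eta>M" using kernel_norm_upper[OF C0] by (simp add: r_def)
    ultimately have r: "0 < r" "r\<^sup>2 \<le> \<eta>M" .
    have D: "1 + complex_of_real s * t = 1 / (1 - complex_of_real s * lam)"
      using Im_Moebius(1)[OF \<open>Im lam \<noteq> 0\<close>, of s] by (simp add: t_def field_simps)
    then have Dnz: "1 + complex_of_real s * t \<noteq> 0"
      using Im_Moebius(1)[OF \<open>Im lam \<noteq> 0\<close>, of s] by simp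
    have lam: "lam = t / (1 + complex_of_real s * t)"
      unfolding D using Im_Moebius(1)[OF \<open>Im lam \<noteq> 0\<close>, of s] by (simp add: t_def)
    \<comment> \<open>The left side is the value of the increasing map \<open>r / (1 + s r)\<close>
      at \<open>\<xi>m / 2\<close>, a lower bound for \<open>r\<close>.\<close>
    have "\<xi>m / (2 + s * \<xi>m) \<le> r / (1 + s * r)"
    proof -
      have "\<xi>m * (1 + s * r) \<le> r * (2 + s * \<xi>m)"
        using x by (simp add: algebra_simps)
      then show ?thesis
        using s r \<xi>m_pos by (simp add: pos_divide_le_eq pos_le_divide_eq add_pos_pos)
    qed
    also have "\<dots> \<le> r / cmod (1 + complex_of_real s * t)"
    proof (intro divide_left_mono)
      show "cmod (1 + complex_of_real s * t) \<le> 1 + s * r"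
        using norm_triangle_ineq[of 1 "complex_of_real s * t"] s by (simp add: norm_mult r_def)
      show "0 < (1 + s * r) * cmod (1 + complex_of_real s * t)"
        using Dnz s r by (simp add: add_pos_pos)
    qed (use r in simp)
    also have "\<dots> = cmod lam"
      unfolding lam r_def by (simp add: norm_divide)
    finally have lower: "\<xi>m / (2 + s * \<xi>m) \<le> cmod lam" .
    have D2: "(cmod (1 + complex_of_real s * t))\<^sup>2 = 1 + 2 * s * x + s\<^sup>2 * r\<^sup>2"
      unfolding r_def x_def cmod_power2 by (simp add: power2_eq_square algebra_simps)
    have pos: "0 < 1 + 2 * s * x + s\<^sup>2 * r\<^sup>2" "0 < 1 + s * \<xi>m + s\<^sup>2 * \<eta>M"
      using s x \<xi>m_pos \<eta>M_nonneg by (auto intro!: add_pos_nonneg)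
    \<comment> \<open>After cross-multiplication of the upper bound, \<open>s^2 r^2 \<eta>M\<close>
      stands on both sides; what remains is a product of two inequalities.\<close>
    have "s * \<xi>m \<le> s * (2 * x)"
      using x(1) s by simp
    then have "r\<^sup>2 * (1 + s * \<xi>m) \<le> \<eta>M * (1 + 2 * s * x)"
      using r s \<xi>m_pos \<eta>M_nonneg by (intro mult_mono) auto
    then have "r\<^sup>2 * (1 + s * \<xi>m + s\<^sup>2 * \<eta>M) \<le> \<eta>M * (1 + 2 * s * x + s\<^sup>2 * r\<^sup>2)"
      by (simp add: algebra_simps)
    then have "r\<^sup>2 / (1 + 2 * s * x + s\<^sup>2 * r\<^sup>2) \<le> \<eta>M / (1 + s * \<xi>m + s\<^sup>2 * \<eta>M)"
      using pos by (simp add: pos_divide_le_eq pos_le_divide_eq mult.commute)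
    moreover have "(cmod lam)\<^sup>2 = r\<^sup>2 / (1 + 2 * s * x + s\<^sup>2 * r\<^sup>2)"
      unfolding D2[symmetric] unfolding lam r_def by (simp add: norm_divide power_divide)
    ultimately have "cmod lam \<le> sqrt (\<eta>M / (1 + s * \<xi>m + s\<^sup>2 * \<eta>M))"
      by (intro real_le_rsqrt) simp
    with lower show ?thesis by simp
  qed
  have "\<bar>Im t\<bar> \<le> sqrt (\<eta>M + \<theta>M)"
    using Im_bound by (intro real_le_rsqrt) simp
  then show ?thesis
    using case1 Re_upper Re_lower unfolding names t_def[symmetric] by blast
qed

end
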